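(* Let $X$ be a separable Banach space, $Y$ a Banach space, $G \subset X$ an open set, and $f: G \to Y$ a pointwise Lipschitz mapping. Then there exists a $\sigma$-directionally porous set $A \subset G$ such that the following implication holds at each point $x \in G \setminus A$: if the one-sided directional derivative $f'_{+}(x,u)$ exists in all directions $u$ from some set $S_x \subset X$ whose linear span is dense in $X$, then $f$ is Gâteaux differentiable at $x$.
   Context: All Banach spaces are real. $B(x,r)$ denotes the open ball with center $x$ and radius $r$. The mapping $f: G \to Y$ is Lipschitz at $x \in G$ if $\limsup_{y \to x} \frac{\|f(y)-f(x)\|}{\|y-x\|} < \infty$; it is pointwise Lipschitz (on $G$) if it is Lipschitz at every point of $G$. Directional porosity: a set $A \subset X$ is directionally porous at a point $x \in X$ if there exist $0 \neq v \in X$, $p>0$ and a sequence $t_n \to 0$ of positive real numbers such that $B(x+t_n v, p t_n) \cap A = \emptyset$ for every $n$. The set $A$ is directionally porous if it is directionally porous at each point $x \in A$, and $\sigma$-directionally porous if it is a countable union of directionally porous sets. One-sided directional derivative of $f$ at $x \in G$ in the direction $v \in X$: $f'_+(x,v) := \lim_{t \to 0+} \frac{f(x+tv)-f(x)}{t}$ (limit in the norm of $Y$). Gâteaux differentiability (standard): $f$ is Gâteaux differentiable at $x$ if there is a continuous linear operator $L: X \to Y$ such that $\lim_{t \to 0} \frac{f(x+tv)-f(x)}{t} = L(v)$ for each $v \in X$. *)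

theory Defs
  imports "HOL-Analysis.Analysis"
begin

text \<open>A map \<open>f : G \<rightarrow> Y\<close> is represented by a total function of which only the values on \<open>G\<close>
  matter; hence the filter \<open>at x within G\<close>, which is \<open>at x\<close> when \<open>G\<close> is open.\<close>

definition Lipschitz_at_within ::
    "('a::real_normed_vector \<Rightarrow> 'b::real_normed_vector) \<Rightarrow> 'a \<Rightarrow> 'a set \<Rightarrow> bool" where
  "Lipschitz_at_within f x G \<longleftrightarrow>
     Limsup (at x within G) (\<lambda>y. ereal (norm (f y - f x) / norm (y - x))) < \<infinity>"

definition pointwise_Lipschitz_on ::
    "'a::real_normed_vector set \<Rightarrow> ('a \<Rightarrow> 'b::real_normed_vector) \<Rightarrow> bool" where
  "pointwise_Lipschitz_on G f \<longleftrightarrow> (\<forall>x\<in>G. Lipschitz_at_within f x G)"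

definition directionally_porous_at :: "'a::real_normed_vector set \<Rightarrow> 'a \<Rightarrow> bool" where
  "directionally_porous_at A x \<longleftrightarrow>
     (\<exists>v p. \<exists>t::nat \<Rightarrow> real. v \<noteq> 0 \<and> p > 0 \<and> (\<forall>n. t n > 0) \<and> t \<longlonglongrightarrow> 0 \<and>
        (\<forall>n. ball (x + t n *\<^sub>R v) (p * t n) \<inter> A = {}))"

definition directionally_porous :: "'a::real_normed_vector set \<Rightarrow> bool" where
  "directionally_porous A \<longleftrightarrow> (\<forall>x\<in>A. directionally_porous_at A x)"

definition sigma_directionally_porous :: "'a::real_normed_vector set \<Rightarrow> bool" where
  "sigma_directionally_porous A \<longleftrightarrow>
     (\<exists>\<A>. countable \<A> \<and> (\<forall>B\<in>\<A>. directionally_porous B) \<and> A = \<Union>\<A>)"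

text \<open>The derivatives below are meant at interior points \<open>x\<close> of the domain of \<open>f\<close>: there
  \<open>x + t *\<^sub>R v\<close> lies in the domain for all small \<open>t\<close>, so values outside it are irrelevant.\<close>

definition has_right_directional_derivative ::
    "('a::real_normed_vector \<Rightarrow> 'b::real_normed_vector) \<Rightarrow> 'b \<Rightarrow> 'a \<Rightarrow> 'a \<Rightarrow> bool" where
  "has_right_directional_derivative f l x v \<longleftrightarrow>
     ((\<lambda>t. (f (x + t *\<^sub>R v) - f x) /\<^sub>R t) \<longlongrightarrow> l) (at_right 0)"

definition Gateaux_differentiable_at ::
    "('a::real_normed_vector \<Rightarrow> 'b::real_normed_vector) \<Rightarrow> 'a \<Rightarrow> bool" where
  "Gateaux_differentiable_at f x \<longleftrightarrow>
     (\<exists>L. bounded_linear L \<and>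
        (\<forall>v. ((\<lambda>t. (f (x + t *\<^sub>R v) - f x) /\<^sub>R t) \<longlongrightarrow> L v) (at 0)))"

end

theory Submission
  imports Defs
begin

text \<open>Let \<open>G\<^bsub>K\<^esub>\<close> be the set of points \<open>z\<close> with \<open>norm (f y - f z) \<le> K * norm (y - z)\<close> for
  \<open>y\<close> closer than \<open>1/K\<close> to \<open>z\<close>. If \<open>A \<subseteq> G\<^bsub>K\<^esub>\<close> is not directionally porous at \<open>x \<in> A\<close>, then every
  \<open>x + t w\<close> with small \<open>t > 0\<close> has a point of \<open>A\<close> at distance \<open>o(t)\<close>. Applied to \<open>A = G\<^bsub>K\<^esub>\<close> this
  makes the difference quotients \<open>q\<^sub>t\<close> at \<open>x\<close> asymptotically \<open>K\<close>-Lipschitz in the direction.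
  Applied to the points of \<open>G\<^bsub>K\<^esub>\<close> where \<open>q\<^sub>t(d)\<close> is \<open>\<epsilon>\<close>-close to \<open>y\<close> for all \<open>t < 1/K\<close>, it transports
  this estimate from \<open>x\<close> to \<open>x + t w\<close>, so that \<open>q\<^sub>t(w + d) - q\<^sub>t(w)\<close> is almost \<open>\<epsilon>\<close>-close to \<open>y\<close>
  for \<^emph>\<open>every\<close> \<open>w\<close>. Since \<open>d\<close>, \<open>y\<close>, \<open>K\<close>, \<open>\<epsilon>\<close> may be restricted to countable sets, the points
  excluded form a \<open>\<sigma>\<close>-directionally porous set. At the other points the directions of right
  differentiability form a closed subspace on which the derivative is linear and bounded.\<close>

section \<open>Difference quotients and quantitative Lipschitz bounds at a point\<close>

definition diff_quot :: "('a::real_normed_vector \<Rightarrow> 'b::real_normed_vector) \<Rightarrow> 'a \<Rightarrow> real \<Rightarrow> 'a \<Rightarrow> 'b"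
  where "diff_quot f x t u = (f (x + t *\<^sub>R u) - f x) /\<^sub>R t"

text \<open>One constant serves as slope bound and as reciprocal of the radius, so for positive
  \<open>K\<close> the condition weakens as \<open>K\<close> grows, and integer values
  suffice.\<close>

definition Lipschitz_near ::
    "('a::real_normed_vector \<Rightarrow> 'b::real_normed_vector) \<Rightarrow> real \<Rightarrow> 'a \<Rightarrow> bool" where
  "Lipschitz_near f K z \<longleftrightarrow> (\<forall>y. norm (y - z) < 1 / K \<longrightarrow> norm (f y - f z) \<le> K * norm (y - z))"

lemma Lipschitz_nearD:
  assumes "Lipschitz_near f K z" "norm (y - z) < 1 / K"
  shows "norm (f y - f z) \<le> K * norm (y - z)" "norm (f z - f y) \<le> K * norm (y - z)"
  using assms by (auto simp: Lipschitz_near_def norm_minus_commute)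

lemma Lipschitz_near_le:
  assumes "Lipschitz_near f K z" "0 < K" "norm (y - z) \<le> c" "c < 1 / K"
  shows "norm (f y - f z) \<le> K * c" "norm (f z - f y) \<le> K * c"
proof -
  have "norm (f y - f z) \<le> K * norm (y - z)"
    using assms by (intro Lipschitz_nearD) auto
  also have "\<dots> \<le> K * c"
    using assms by simp
  finally show "norm (f y - f z) \<le> K * c" "norm (f z - f y) \<le> K * c"
    by (simp_all add: norm_minus_commute)
qed

lemma Lipschitz_near_mono:
  assumes "Lipschitz_near f K z" "0 < K" "K \<le> K'"
  shows "Lipschitz_near f K' z"
  unfolding Lipschitz_near_def
proof (intro allI impI)
  fix y assume "norm (y - z) < 1 / K'"
  also have "1 / K' \<le> 1 / K"
    using assms by (simp add: frac_le)
  finally have "norm (f y - f z) \<le> K * norm (y - z)"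
    using Lipschitz_nearD assms(1) by blast
  also have "\<dots> \<le> K' * norm (y - z)"
    using assms(3) by (simp add: mult_right_mono)
  finally show "norm (f y - f z) \<le> K' * norm (y - z)" .
qed

lemma Lipschitz_near_isCont:
  assumes "Lipschitz_near f K x" "0 < K"
  shows "isCont f x"
proof -
  have "\<forall>\<^sub>F y in at x. norm (f y - f x) \<le> K * norm (y - x)"
    unfolding eventually_at
    by (rule exI[of _ "1 / K"]) (use assms in \<open>auto simp: dist_norm intro: Lipschitz_nearD\<close>)
  moreover have "((\<lambda>y. K * norm (y - x)) \<longlongrightarrow> 0) (at x)"
    by (rule tendsto_eq_intros refl | simp)+
  ultimately have "((\<lambda>y. f y - f x) \<longlongrightarrow> 0) (at x)"
    by (rule Lim_null_comparison)
  then show ?thesis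
    by (simp add: isCont_def LIM_zero_iff)
qed

lemma Lipschitz_at_within_imp_near:
  assumes "Lipschitz_at_within f x G" "open G" "x \<in> G"
  shows "\<exists>n. Lipschitz_near f (real (Suc n)) x"
proof -
  have "Limsup (at x) (\<lambda>y. ereal (norm (f y - f x) / norm (y - x))) < \<infinity>"
    using assms(1) unfolding Lipschitz_at_within_def at_within_open[OF assms(3,2)] .
  then obtain C where C: "Limsup (at x) (\<lambda>y. ereal (norm (f y - f x) / norm (y - x))) < ereal C"
    using ereal_dense2 by blast
  then have "\<forall>\<^sub>F y in at x. norm (f y - f x) / norm (y - x) < C"
    using Limsup_lessD by fastforce
  then obtain r where r: "r > 0"
    and rC: "\<And>y. y \<noteq> x \<Longrightarrow> norm (y - x) < r \<Longrightarrow> norm (f y - f x) / norm (y - x) < C"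
    unfolding eventually_at by (auto simp: dist_norm)
  \<comment> \<open>One integer has to dominate both the slope bound \<open>C\<close> and the
    reciprocal radius \<open>1 / r\<close>.\<close>
  obtain n where n: "max C (1 / r) < real n"
    using reals_Archimedean2 by blast
  have "1 / r < real (Suc n)"
    using n by simp
  then have "1 / real (Suc n) < r"
    using r by (simp add: divide_less_eq mult.commute del: of_nat_Suc)
  moreover have "norm (f y - f x) \<le> real (Suc n) * norm (y - x)" if "norm (y - x) < r" for y
  proof (cases "y = x")
    case False
    then have "norm (f y - f x) \<le> C * norm (y - x)"
      using rC[OF False that] by (simp add: field_simps)
    also have "\<dots> \<le> real (Suc n) * norm (y - x)"
      using n by (intro mult_right_mono) auto
    finally show ?thesis .
  qed simp
  ultimately show ?thesis
    unfolding Lipschitz_near_def by (intro exI[of _ n]) auto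
qed

section \<open>Directional porosity\<close>

lemma directionally_porous_at_subset:
  assumes "directionally_porous_at A x" "B \<subseteq> A"
  shows "directionally_porous_at B x"
proof -
  have "ball y r \<inter> B = {}" if "ball y r \<inter> A = {}" for y r
    using that assms(2) by blast
  then show ?thesis
    using assms(1) unfolding directionally_porous_at_def by meson
qed

text \<open>Porosity at a point passes to subsets, so keeping only the porosity points of an
  arbitrary set leaves a directionally porous set. The exceptional set of the theorem is a union of
  such pieces.\<close>

lemma directionally_porous_porous_part:
  "directionally_porous {x \<in> A. directionally_porous_at A x}"
  unfolding directionally_porous_def
  using directionally_porous_at_subset[of A _ "{x \<in> A. directionally_porous_at A x}"] by blast

text \<open>If balls missed \<open>A\<close> for arbitrarily small \<open>t\<close>, a null sequence
  of such \<open>t\<close> would witness porosity. Porosity admits any positive constant, so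
  \<open>p\<close> can be prescribed.\<close>

lemma not_directionally_porous_atD:
  assumes "\<not> directionally_porous_at A x" "x \<in> A" "0 < p"
  shows "\<forall>\<^sub>F t in at_right 0. \<exists>z\<in>A. norm (x + t *\<^sub>R v - z) < p * t"
proof (cases "v = 0")
  \<comment> \<open>Porosity ignores the zero direction; here \<open>x\<close> itself is the nearby
    point of \<open>A\<close>.\<close>
  case True
  have "\<forall>\<^sub>F t in at_right 0. 0 < (t::real)"
    by (simp add: eventually_at_right_less)
  then show ?thesis
    by eventually_elim (use assms True in \<open>auto intro!: bexI[of _ x]\<close>)
next
  case False
  show ?thesis
  proof (rule ccontr)
    assume neg: "\<not> ?thesis"
    have "\<exists>t. 0 < t \<and> t < inverse (real (Suc n)) \<and> ball (x + t *\<^sub>R v) (p * t) \<inter> A = {}" for n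
    proof (rule ccontr)
      assume c: "\<not> ?thesis"
      have "\<forall>\<^sub>F t in at_right 0. t < inverse (real (Suc n))"
        by (intro order_tendstoD[OF tendsto_ident_at]) simp
      moreover have "\<forall>\<^sub>F t in at_right 0. 0 < (t::real)"
        by (simp add: eventually_at_right_less)
      ultimately have "\<forall>\<^sub>F t in at_right 0. \<exists>z\<in>A. norm (x + t *\<^sub>R v - z) < p * t"
        by eventually_elim (use c in \<open>force simp: dist_norm\<close>)
      with neg show False by simp
    qed
    then obtain t where t: "\<And>n. 0 < t n" "\<And>n. t n < inverse (real (Suc n))"
      "\<And>n. ball (x + t n *\<^sub>R v) (p * t n) \<inter> A = {}"
      by metis
    have "t \<longlonglongrightarrow> 0"
      by (rule tendsto_sandwich[OF _ _ tendsto_const LIMSEQ_inverse_real_of_nat])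
        (use t in \<open>auto intro!: always_eventually less_imp_le\<close>)
    with t False assms show False
      unfolding directionally_porous_at_def by blast
  qed
qed

section \<open>Difference quotients at points of non-porosity\<close>

lemma eventually_at_right_mult_less:
  fixes c r :: real
  assumes "0 < r"
  shows "\<forall>\<^sub>F t in at_right 0. c * t < r"
proof -
  have "((\<lambda>t. c * t) \<longlongrightarrow> c * 0) (at_right 0)"
    by (intro tendsto_intros)
  then show ?thesis
    using assms by (intro order_tendstoD) simp_all
qed

text \<open>Neither end point need lie in \<open>A\<close>, but some \<open>z\<close> in
  \<open>A\<close> is within \<open>p * t\<close> of \<open>x + t *\<^sub>R u\<close>. The Lipschitz
  bound centred at \<open>z\<close> controls both values of \<open>f\<close>.\<close>

lemma diff_quot_asymp_Lipschitz:
  assumes lip: "\<And>z. z \<in> A \<Longrightarrow> Lipschitz_near f K z" and K: "0 < K"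
    and x: "x \<in> A" "\<not> directionally_porous_at A x" and e: "0 < e"
  shows "\<forall>\<^sub>F t in at_right 0. norm (diff_quot f x t u - diff_quot f x t v) \<le> K * norm (u - v) + e"
proof -
  \<comment> \<open>The detour through \<open>z\<close> adds \<open>K * p * t\<close> twice,
    together \<open>e * t\<close>.\<close>
  define p where "p = e / (2 * K)"
  have p: "0 < p" "2 * K * p = e" using K e by (auto simp: p_def)
  have "\<forall>\<^sub>F t in at_right 0. \<exists>z\<in>A. norm (x + t *\<^sub>R u - z) < p * t"
    using not_directionally_porous_atD x p(1) by blast
  moreover have "\<forall>\<^sub>F t in at_right 0. (p + norm (u - v)) * t < 1 / K"
    using K by (intro eventually_at_right_mult_less) simp
  moreover have "\<forall>\<^sub>F t in at_right 0. 0 < (t::real)"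
    by (simp add: eventually_at_right_less)
  ultimately show ?thesis
  proof eventually_elim
    case (elim t)
    then obtain z where z: "z \<in> A" "norm (x + t *\<^sub>R u - z) < p * t" by blast
    have "x + t *\<^sub>R v - z = (x + t *\<^sub>R u - z) - t *\<^sub>R (u - v)"
      by (simp add: algebra_simps)
    then have "norm (x + t *\<^sub>R v - z) \<le> norm (x + t *\<^sub>R u - z) + norm (t *\<^sub>R (u - v))"
      by (metis norm_triangle_ineq4)
    then have nv: "norm (x + t *\<^sub>R v - z) \<le> (p + norm (u - v)) * t"
      using z(2) elim(3) unfolding distrib_right by (simp add: mult.commute)
    have "p * t \<le> (p + norm (u - v)) * t"
      using elim(3) by (intro mult_right_mono) auto
    then have pt: "p * t < 1 / K"
      using elim(2) by linarith
    have 1: "norm (f (x + t *\<^sub>R u) - f z) \<le> K * (p * t)"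
      using z(2) by (intro Lipschitz_near_le[OF lip[OF z(1)] K _ pt]) simp
    have 2: "norm (f z - f (x + t *\<^sub>R v)) \<le> K * ((p + norm (u - v)) * t)"
      by (rule Lipschitz_near_le[OF lip[OF z(1)] K nv elim(2)])
    have "norm (f (x + t *\<^sub>R u) - f (x + t *\<^sub>R v)) \<le> K * (p * t) + K * ((p + norm (u - v)) * t)"
      using norm_triangle_ineq[of "f (x + t *\<^sub>R u) - f z" "f z - f (x + t *\<^sub>R v)"] 1 2 by simp
    also have "\<dots> = (K * norm (u - v) + e) * t"
      unfolding p(2)[symmetric] by (simp add: algebra_simps)
    finally have "norm (f (x + t *\<^sub>R u) - f (x + t *\<^sub>R v)) / t \<le> K * norm (u - v) + e"
      using elim(3) by (simp add: divide_le_eq)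
    moreover have "diff_quot f x t u - diff_quot f x t v = (f (x + t *\<^sub>R u) - f (x + t *\<^sub>R v)) /\<^sub>R t"
      by (simp add: diff_quot_def scaleR_diff_right)
    ultimately show ?case
      using elim(3) by (simp add: divide_inverse mult.commute)
  qed
qed

text \<open>The bound \<open>approx\<close> holds on one range of \<open>t\<close> for all of
  \<open>A\<close>, so it applies at a point \<open>z\<close> near \<open>x + t *\<^sub>R w\<close>
  that varies with \<open>t\<close>. Since \<open>z + t *\<^sub>R d\<close> need not lie in
  \<open>A\<close>, a second point \<open>z'\<close> of \<open>A\<close> near
  \<open>x + t *\<^sub>R (w + d)\<close> links the values of \<open>f\<close> at the far
  ends.\<close>

lemma diff_quot_add_approx:
  assumes lip: "\<And>z. z \<in> A \<Longrightarrow> Lipschitz_near f K z" and K: "0 < K"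
    and approx: "\<And>z t. z \<in> A \<Longrightarrow> 0 < t \<Longrightarrow> t < 1 / K \<Longrightarrow> norm (diff_quot f z t d - y) \<le> \<epsilon>"
    and x: "x \<in> A" "\<not> directionally_porous_at A x" and e: "0 < e"
  shows "\<forall>\<^sub>F t in at_right 0. norm (diff_quot f x t (w + d) - diff_quot f x t w - y) \<le> \<epsilon> + e"
proof -
  \<comment> \<open>The three replacements below cost \<open>K * p * t\<close>,
    \<open>2 * K * p * t\<close> and \<open>K * p * t\<close>, together
    \<open>e * t\<close>.\<close>
  define p where "p = e / (4 * K)"
  have p: "0 < p" "4 * K * p = e" using K e by (auto simp: p_def)
  have "\<forall>\<^sub>F t in at_right 0. \<exists>z\<in>A. norm (x + t *\<^sub>R w - z) < p * t"
    and "\<forall>\<^sub>F t in at_right 0. \<exists>z\<in>A. norm (x + t *\<^sub>R (w + d) - z) < p * t"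
    using not_directionally_porous_atD x p(1) by blast+
  moreover have "\<forall>\<^sub>F t in at_right 0. 2 * p * t < 1 / K" "\<forall>\<^sub>F t in at_right 0. 1 * t < 1 / K"
    using K by (intro eventually_at_right_mult_less; simp)+
  moreover have "\<forall>\<^sub>F t in at_right 0. 0 < (t::real)"
    by (simp add: eventually_at_right_less)
  ultimately show ?thesis
  proof eventually_elim
    case (elim t)
    then obtain z z' where z: "z \<in> A" "norm (x + t *\<^sub>R w - z) < p * t"
      and z': "z' \<in> A" "norm (x + t *\<^sub>R (w + d) - z') < p * t" by blast
    have "0 < p * t" using p elim by simp
    then have pt: "p * t < 1 / K" using elim(3) by linarith
    have 1: "norm (f (x + t *\<^sub>R (w + d)) - f z') \<le> K * (p * t)"
      using z'(2) by (intro Lipschitz_near_le[OF lip[OF z'(1)] K _ pt]) simp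
    have 2: "norm (f z - f (x + t *\<^sub>R w)) \<le> K * (p * t)"
      using z(2) by (intro Lipschitz_near_le[OF lip[OF z(1)] K _ pt]) simp
    have "z + t *\<^sub>R d - z' = (x + t *\<^sub>R (w + d) - z') - (x + t *\<^sub>R w - z)"
      by (simp add: algebra_simps)
    then have "norm (z + t *\<^sub>R d - z') \<le> norm (x + t *\<^sub>R (w + d) - z') + norm (x + t *\<^sub>R w - z)"
      by (metis norm_triangle_ineq4)
    then have "norm (z + t *\<^sub>R d - z') \<le> 2 * p * t"
      using z(2) z'(2) by linarith
    then have 3: "norm (f z' - f (z + t *\<^sub>R d)) \<le> K * (2 * p * t)"
      by (rule Lipschitz_near_le[OF lip[OF z'(1)] K _ elim(3)])
    have 4: "norm (diff_quot f z t d - y) \<le> \<epsilon>"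
      using approx[OF z(1)] elim by simp
    \<comment> \<open>\<open>R\<close> is the error of replacing the increment of \<open>f\<close>
      from \<open>x + t *\<^sub>R w\<close> to \<open>x + t *\<^sub>R (w + d)\<close> by the one
      from \<open>z\<close> to \<open>z + t *\<^sub>R d\<close>.\<close>
    define R where "R = (f (x + t *\<^sub>R (w + d)) - f z') + (f z' - f (z + t *\<^sub>R d))
      + (f z - f (x + t *\<^sub>R w))"
    have "norm R \<le> K * (p * t) + K * (2 * p * t) + K * (p * t)"
      unfolding R_def using 1 2 3 by (meson add_mono norm_triangle_le order_trans norm_triangle_ineq)
    also have "\<dots> = e * t"
      unfolding p(2)[symmetric] by (simp add: algebra_simps)
    finally have "norm (R /\<^sub>R t) \<le> e"
      using elim(5) by (simp add: field_simps)
    moreover have "diff_quot f x t (w + d) - diff_quot f x t w - y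
        = R /\<^sub>R t + (diff_quot f z t d - y)"
      unfolding R_def diff_quot_def by (simp add: algebra_simps)
    ultimately show ?case
      using 4 norm_triangle_le[of "R /\<^sub>R t" "diff_quot f z t d - y" "\<epsilon> + e"] by (metis add.commute add_mono)
  qed
qed

section \<open>Right derivatives at a fixed point\<close>

lemma right_derivative_scale:
  assumes "((\<lambda>t. diff_quot f x t u) \<longlongrightarrow> l) (at_right 0)" "0 < c"
  shows "((\<lambda>t. diff_quot f x t (c *\<^sub>R u)) \<longlongrightarrow> c *\<^sub>R l) (at_right 0)"
proof -
  have "filterlim (\<lambda>t. c * t) (at_right 0) (at_right 0)"
    unfolding filterlim_at
  proof
    show "\<forall>\<^sub>F t in at_right 0. c * t \<in> {0<..} \<and> c * t \<noteq> 0"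
      using eventually_at_right_less[of "0::real"] by eventually_elim (use assms in auto)
    show "((\<lambda>t. c * t) \<longlongrightarrow> 0) (at_right 0)"
      by (rule tendsto_eq_intros refl | simp)+
  qed
  from filterlim_compose[OF assms(1) this]
  have "((\<lambda>t. c *\<^sub>R diff_quot f x (c * t) u) \<longlongrightarrow> c *\<^sub>R l) (at_right 0)"
    by (intro tendsto_intros)
  moreover have "c *\<^sub>R diff_quot f x (c * t) u = diff_quot f x t (c *\<^sub>R u)" for t
    using assms(2) by (simp add: diff_quot_def mult.commute)
  ultimately show ?thesis by simp
qed

lemma right_derivative_norm_diff_le:
  assumes lip: "\<And>u v e. 0 < e \<Longrightarrow>
      \<forall>\<^sub>F t in at_right 0. norm (diff_quot f x t u - diff_quot f x t v) \<le> K * norm (u - v) + e"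
    and u: "((\<lambda>t. diff_quot f x t u) \<longlongrightarrow> l) (at_right 0)"
    and v: "((\<lambda>t. diff_quot f x t v) \<longlongrightarrow> m) (at_right 0)"
  shows "norm (l - m) \<le> K * norm (u - v)"
proof (rule field_le_epsilon)
  fix e :: real assume "0 < e"
  have "((\<lambda>t. norm (diff_quot f x t u - diff_quot f x t v)) \<longlongrightarrow> norm (l - m)) (at_right 0)"
    using u v by (intro tendsto_intros)
  then show "norm (l - m) \<le> K * norm (u - v) + e"
    by (rule tendsto_upperbound) (use lip[OF \<open>0 < e\<close>] in auto)
qed

text \<open>The asymptotic Lipschitz bound makes the derivatives along a convergent sequence of
  directions Cauchy. Completeness of the target gives a candidate limit, which the same bound
  confirms.\<close>

lemma closed_right_derivative_directions:
  fixes f :: "'a::real_normed_vector \<Rightarrow> 'b::banach"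
  assumes lip: "\<And>u v e. 0 < e \<Longrightarrow>
      \<forall>\<^sub>F t in at_right 0. norm (diff_quot f x t u - diff_quot f x t v) \<le> K * norm (u - v) + e"
    and K: "0 < K"
  shows "closed {u. \<exists>l. ((\<lambda>t. diff_quot f x t u) \<longlongrightarrow> l) (at_right 0)}"
  unfolding closed_sequential_limits
proof (intro allI impI)
  fix v u assume "(\<forall>n. v n \<in> {u. \<exists>l. ((\<lambda>t. diff_quot f x t u) \<longlongrightarrow> l) (at_right 0)}) \<and> v \<longlonglongrightarrow> u"
  then obtain l where l: "\<And>n. ((\<lambda>t. diff_quot f x t (v n)) \<longlongrightarrow> l n) (at_right 0)" and v: "v \<longlonglongrightarrow> u"
    by (auto simp: choice_iff)
  have "Cauchy l"
  proof (rule metric_CauchyI)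
    fix e :: real assume e: "0 < e"
    obtain M where M: "\<And>m n. m \<ge> M \<Longrightarrow> n \<ge> M \<Longrightarrow> dist (v m) (v n) < e / K"
      using metric_CauchyD[OF LIMSEQ_imp_Cauchy[OF v], of "e / K"] e K by auto
    have "dist (l m) (l n) < e" if "m \<ge> M" "n \<ge> M" for m n
      using right_derivative_norm_diff_le[OF lip l l, of m n] M[OF that] K
      by (simp add: dist_norm field_simps)
    then show "\<exists>M. \<forall>m\<ge>M. \<forall>n\<ge>M. dist (l m) (l n) < e" by blast
  qed
  then obtain L where L: "l \<longlonglongrightarrow> L"
    using Cauchy_convergent convergent_def by blast
  have "((\<lambda>t. diff_quot f x t u) \<longlongrightarrow> L) (at_right 0)"
  proof (rule tendstoI)
    fix e :: real assume e: "0 < e"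
    \<comment> \<open>Two quarters compare the quotients along \<open>u\<close> and
      \<open>v n\<close>; the others bound the distances from the latter to \<open>l n\<close> and
      from \<open>l n\<close> to \<open>L\<close>.\<close>
    then have e4: "0 < e / 4" by simp
    have "\<forall>\<^sub>F n in sequentially. dist (v n) u < e / 4 / K" "\<forall>\<^sub>F n in sequentially. dist (l n) L < e / 4"
      by (rule tendstoD[OF v] tendstoD[OF L], use e K in simp)+
    then have "\<forall>\<^sub>F n in sequentially. dist (v n) u < e / 4 / K \<and> dist (l n) L < e / 4"
      by eventually_elim simp
    then obtain n where n: "dist (v n) u < e / 4 / K" "dist (l n) L < e / 4"
      using eventually_happens' sequentially_bot by blast
    have "K * norm (u - v n) < e / 4"
      using n(1) K by (simp add: dist_norm norm_minus_commute field_simps)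
    from lip[OF e4, of u "v n"] tendstoD[OF l e4, of n]
    show "\<forall>\<^sub>F t in at_right 0. dist (diff_quot f x t u) L < e"
    proof eventually_elim
      case (elim t)
      have "dist (diff_quot f x t u) (diff_quot f x t (v n)) < e / 4 + e / 4"
        using elim(1) \<open>K * norm (u - v n) < e / 4\<close> by (simp add: dist_norm)
      then show ?case
        using elim(2) n(2) dist_triangle[of "diff_quot f x t u" L "diff_quot f x t (v n)"]
          dist_triangle[of "diff_quot f x t (v n)" L "l n"] by simp
    qed
  qed
  then show "u \<in> {u. \<exists>l. ((\<lambda>t. diff_quot f x t u) \<longlongrightarrow> l) (at_right 0)}" by blast
qed

text \<open>The hypothesis \<open>add\<close> covers every \<open>w\<close>, even one along which
  convergence is unknown. It makes the good directions a subspace, which is closed and contains a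
  dense span, hence is the whole space.\<close>

lemma Gateaux_differentiable_atI:
  fixes f :: "'a::real_normed_vector \<Rightarrow> 'b::banach"
  assumes lip: "\<And>u v e. 0 < e \<Longrightarrow>
      \<forall>\<^sub>F t in at_right 0. norm (diff_quot f x t u - diff_quot f x t v) \<le> K * norm (u - v) + e"
    and K: "0 < K"
    and add: "\<And>u l w. ((\<lambda>t. diff_quot f x t u) \<longlongrightarrow> l) (at_right 0) \<Longrightarrow>
      ((\<lambda>t. diff_quot f x t (w + u) - diff_quot f x t w) \<longlongrightarrow> l) (at_right 0)"
    and S: "closure (span S) = UNIV"
      "\<And>u. u \<in> S \<Longrightarrow> \<exists>l. ((\<lambda>t. diff_quot f x t u) \<longlongrightarrow> l) (at_right 0)"
  shows "Gateaux_differentiable_at f x"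
proof -
  define V where "V = {u. \<exists>l. ((\<lambda>t. diff_quot f x t u) \<longlongrightarrow> l) (at_right 0)}"
  have zero: "((\<lambda>t. diff_quot f x t 0) \<longlongrightarrow> 0) (at_right 0)"
    by (simp add: diff_quot_def)
  have plus: "((\<lambda>t. diff_quot f x t (u + v)) \<longlongrightarrow> l + m) (at_right 0)"
    if u: "((\<lambda>t. diff_quot f x t u) \<longlongrightarrow> l) (at_right 0)"
      and v: "((\<lambda>t. diff_quot f x t v) \<longlongrightarrow> m) (at_right 0)" for u v l m
    using tendsto_add[OF u add[OF v, of u]] by simp
  \<comment> \<open>For \<open>w = - u\<close> the quotient along \<open>w + u = 0\<close> vanishes,
    so \<open>add\<close> forces convergence along \<open>- u\<close>. This is how one-sided
    derivatives become two-sided.\<close>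
  have uminus: "((\<lambda>t. diff_quot f x t (- u)) \<longlongrightarrow> - l) (at_right 0)"
    if u: "((\<lambda>t. diff_quot f x t u) \<longlongrightarrow> l) (at_right 0)" for u l
    using tendsto_diff[OF zero add[OF u, of "- u"]] by (simp add: diff_quot_def)
  have scale: "((\<lambda>t. diff_quot f x t (c *\<^sub>R u)) \<longlongrightarrow> c *\<^sub>R l) (at_right 0)"
    if u: "((\<lambda>t. diff_quot f x t u) \<longlongrightarrow> l) (at_right 0)" for c u l
  proof (cases c "0::real" rule: linorder_cases)
    case less
    then show ?thesis
      using right_derivative_scale[OF uminus[OF u], of "- c"] by simp
  next
    case equal
    then show ?thesis using zero by simp
  next
    case greater
    then show ?thesis using right_derivative_scale[OF u] by simp
  qed
  have "subspace V"
    unfolding subspace_def V_def using zero plus scale by blast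
  then have "span S \<subseteq> V"
    using S(2) by (intro span_minimal) (auto simp: V_def)
  moreover have "closed V"
    unfolding V_def by (rule closed_right_derivative_directions[OF lip K])
  ultimately have "V = UNIV"
    using S(1) closure_minimal by blast
  then have "\<forall>u. \<exists>l. ((\<lambda>t. diff_quot f x t u) \<longlongrightarrow> l) (at_right 0)"
    unfolding V_def by blast
  then obtain L where L: "\<And>u. ((\<lambda>t. diff_quot f x t u) \<longlongrightarrow> L u) (at_right 0)"
    by metis
  have uniq: "l = L u" if "((\<lambda>t. diff_quot f x t u) \<longlongrightarrow> l) (at_right 0)" for u l
    using tendsto_unique[OF _ that L] by simp
  have "bounded_linear L"
  proof (rule bounded_linear_intro)
    show "L (u + v) = L u + L v" for u v
      using uniq[OF plus[OF L L]] by simp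
    show "L (c *\<^sub>R u) = c *\<^sub>R L u" for c u
      using uniq[OF scale[OF L]] by simp
    show "norm (L u) \<le> norm u * K" for u
      using right_derivative_norm_diff_le[OF lip L zero, of u] by (simp add: mult.commute)
  qed
  moreover have "((\<lambda>t. diff_quot f x t v) \<longlongrightarrow> L v) (at 0)" for v
  proof (rule filterlim_split_at[OF _ L])
    \<comment> \<open>Changing the sign of \<open>t\<close> turns the left limit along
      \<open>v\<close> into the negated right limit along \<open>- v\<close>.\<close>
    have "((\<lambda>t. - diff_quot f x t (- v)) \<longlongrightarrow> - L (- v)) (at_right 0)"
      by (intro tendsto_intros L)
    moreover have "- diff_quot f x t (- v) = diff_quot f x (- t) v" for t
      by (simp add: diff_quot_def)
    moreover have "- L (- v) = L v"
      using uniq[OF uminus[OF L], of v] by (metis minus_minus)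
    ultimately show "((\<lambda>t. diff_quot f x t v) \<longlongrightarrow> L v) (at_left 0)"
      by (simp add: filterlim_at_left_to_right)
  qed
  ultimately show ?thesis
    unfolding Gateaux_differentiable_at_def diff_quot_def by blast
qed

section \<open>A countable supply of candidate derivatives\<close>

lemma mem_closure_image_dense:
  fixes f :: "'a::metric_space \<Rightarrow> 'b::metric_space"
  assumes "isCont f x" "closure D = UNIV"
  shows "f x \<in> closure (f ` D)"
proof -
  obtain a where "\<And>n. a n \<in> D" "a \<longlonglongrightarrow> x"
    using assms(2) closure_sequential[of x D] by auto
  then show ?thesis
    unfolding closure_sequential using isCont_tendsto_compose[OF assms(1), of a]
    by (intro exI[of _ "f \<circ> a"]) (auto simp: comp_def)
qed

text \<open>The target may be nonseparable, so a countable set approximating all right derivatives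
  is built from a countable dense \<open>D\<close> in the domain: at \<open>t = 1/(n+1)\<close> the
  factor is an integer, and continuity replaces both values of \<open>f\<close> by values on
  \<open>D\<close>.\<close>

lemma right_derivative_mem_closure:
  fixes f :: "'a::real_normed_vector \<Rightarrow> 'b::real_normed_vector"
  assumes "open G" "\<And>z. z \<in> G \<Longrightarrow> isCont f z" "closure D = UNIV" "x \<in> G"
    and l: "((\<lambda>t. diff_quot f x t u) \<longlongrightarrow> l) (at_right 0)"
  shows "l \<in> closure ((\<lambda>(k, a, b). real k *\<^sub>R (f b - f a)) ` (UNIV \<times> D \<times> D))" (is "_ \<in> closure ?E")
proof -
  have lim: "filterlim (\<lambda>n. inverse (real (Suc n))) (at_right 0) sequentially"
    unfolding filterlim_at using LIMSEQ_inverse_real_of_nat by (auto intro!: always_eventually)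
  have "((\<lambda>t. x + t *\<^sub>R u) \<longlongrightarrow> x + 0 *\<^sub>R u) (at_right 0)"
    by (intro tendsto_intros)
  then have "\<forall>\<^sub>F t in at_right 0. x + t *\<^sub>R u \<in> G"
    using assms(1,4) by (intro topological_tendstoD) auto
  with lim have "\<forall>\<^sub>F n in sequentially. x + inverse (real (Suc n)) *\<^sub>R u \<in> G"
    by (rule eventually_compose_filterlim[rotated])
  then have "\<forall>\<^sub>F n in sequentially. diff_quot f x (inverse (real (Suc n))) u \<in> closure ?E"
  proof eventually_elim
    case (elim n)
    obtain a b where a: "\<And>k. a k \<in> f ` D" "a \<longlonglongrightarrow> f x"
      and b: "\<And>k. b k \<in> f ` D" "b \<longlonglongrightarrow> f (x + inverse (real (Suc n)) *\<^sub>R u)"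
      using mem_closure_image_dense[OF assms(2) assms(3), of x]
        mem_closure_image_dense[OF assms(2)[OF elim] assms(3)] assms(4)
      unfolding closure_sequential by blast
    have "(\<lambda>k. real (Suc n) *\<^sub>R (b k - a k)) \<longlonglongrightarrow> diff_quot f x (inverse (real (Suc n))) u"
      unfolding diff_quot_def inverse_inverse_eq using a b by (intro tendsto_intros)
    moreover have "real (Suc n) *\<^sub>R (b k - a k) \<in> ?E" for k
    proof -
      obtain p q where "p \<in> D" "q \<in> D" "a k = f p" "b k = f q" using a b by (meson imageE)
      then show ?thesis by (intro image_eqI[of _ _ "(Suc n, p, q)"]) auto
    qed
    ultimately show ?case
      unfolding closure_sequential by (intro exI conjI allI)
  qed
  moreover have "(\<lambda>n. diff_quot f x (inverse (real (Suc n))) u) \<longlonglongrightarrow> l"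
    using filterlim_compose[OF l lim] .
  ultimately show ?thesis
    by (intro Lim_in_closed_set[of "closure ?E"]) auto
qed

section \<open>Countably many test sets and the exceptional set\<close>

theorem corollary3p6:
  fixes f :: "'a::banach \<Rightarrow> 'b::banach" and G :: "'a set"
  assumes "separable_space (euclidean :: 'a topology)"
    and "open G"
    and "pointwise_Lipschitz_on G f"
  shows "\<exists>A. A \<subseteq> G \<and> sigma_directionally_porous A \<and>
    (\<forall>x\<in>G - A.
       (\<exists>S. closure (span S) = UNIV \<and> (\<forall>u\<in>S. \<exists>l. has_right_directional_derivative f l x u))
         \<longrightarrow> Gateaux_differentiable_at f x)"
proof -
  obtain D :: "'a set" where D: "countable D" "closure D = UNIV"
    using assms(1) unfolding separable_space_def by auto
  define E where "E = (\<lambda>(k, a, b). real k *\<^sub>R (f b - f a)) ` (UNIV \<times> D \<times> D)"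
  have E: "countable E"
    unfolding E_def using D by auto
  define P where "P n = {z \<in> G. Lipschitz_near f (real (Suc n)) z}" for n
  \<comment> \<open>The index \<open>n\<close> fixes the Lipschitz constant, its radius and the
    range of \<open>t\<close> at once, the form used by \<open>diff_quot_add_approx\<close>.\<close>
  define Q where "Q = (\<lambda>(n, j, d, y). {z \<in> P n. \<forall>t. 0 < t \<and> t < 1 / real (Suc n) \<longrightarrow>
      norm (diff_quot f z t d - y) \<le> 1 / real (Suc j)})"
  define F where "F = range P \<union> Q ` (UNIV \<times> UNIV \<times> D \<times> E)"
  \<comment> \<open>Only porosity points are discarded, so off \<open>A\<close> each test set is
    non-porous at every point it contains.\<close>
  define A where "A = \<Union>((\<lambda>B. {x \<in> B. directionally_porous_at B x}) ` F)"
  have "countable F"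
    unfolding F_def using D E by auto
  then have "sigma_directionally_porous A"
    unfolding sigma_directionally_porous_def A_def using directionally_porous_porous_part
    by (intro exI[of _ "(\<lambda>B. {x \<in> B. directionally_porous_at B x}) ` F"]) auto
  moreover have "A \<subseteq> G"
    unfolding A_def F_def P_def Q_def by auto
  moreover have "Gateaux_differentiable_at f x"
    if x: "x \<in> G" "x \<notin> A" and S: "closure (span S) = UNIV"
      "\<forall>u\<in>S. \<exists>l. has_right_directional_derivative f l x u" for x S
  proof -
    have cover: "\<exists>n. z \<in> P n" if "z \<in> G" for z
      using Lipschitz_at_within_imp_near[OF _ assms(2) that] assms(3) that
      unfolding P_def pointwise_Lipschitz_on_def by blast
    then have cont: "isCont f z" if "z \<in> G" for z
      using that Lipschitz_near_isCont unfolding P_def by (metis mem_Collect_eq of_nat_0_less_iff zero_less_Suc)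
    obtain N where N: "x \<in> P N" using cover x by blast
    define K where "K = real (Suc N)"
    have K: "0 < K" by (simp add: K_def)
    have nonporous: "\<not> directionally_porous_at B x" if "B \<in> F" "x \<in> B" for B
      using that x(2) unfolding A_def by blast
    have lip: "\<forall>\<^sub>F t in at_right 0. norm (diff_quot f x t u - diff_quot f x t v) \<le> K * norm (u - v) + e"
      if "0 < e" for u v e
      by (rule diff_quot_asymp_Lipschitz[OF _ K N nonporous[OF _ N] that]) (auto simp: P_def K_def F_def)
    have add: "((\<lambda>t. diff_quot f x t (w + u) - diff_quot f x t w) \<longlongrightarrow> l) (at_right 0)"
      if l: "((\<lambda>t. diff_quot f x t u) \<longlongrightarrow> l) (at_right 0)" for u l w
    proof (rule tendstoI)
      fix e' :: real assume "0 < e'"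
      then obtain j where j: "1 / real (Suc j) < e' / 2"
        using reals_Archimedean[of "e' / 2"] by (auto simp: inverse_eq_divide)
      \<comment> \<open>Comparing the quotient along \<open>d\<close> with \<open>y\<close> costs
        \<open>4 * e\<close>, exactly the accuracy built into \<open>Q\<close>. The final estimate
        totals \<open>8 * e = 2/(j+1)\<close>, which is below \<open>e'\<close> by the choice of
        \<open>j\<close>.\<close>
      define e where "e = 1 / real (Suc j) / 4"
      have e: "0 < e" "4 * e = 1 / real (Suc j)" by (simp_all add: e_def del: of_nat_Suc)
      obtain d where d: "d \<in> D" "dist d u < e / K"
        using D(2) e K by (metis UNIV_I closure_approachable divide_pos_pos)
      then have Kd: "K * norm (u - d) < e"
        using K by (simp add: dist_norm norm_minus_commute field_simps)
      obtain y where y: "y \<in> E" "dist y l < e"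
        using right_derivative_mem_closure[OF assms(2) cont D(2) x(1) l] e(1)
        unfolding E_def closure_approachable by blast
      have "\<forall>\<^sub>F t in at_right 0. norm (diff_quot f x t d - y) \<le> 1 / real (Suc j)"
        using lip[OF e(1), of u d] tendstoD[OF l e(1)]
      proof eventually_elim
        case (elim t)
        have "dist (diff_quot f x t d) (diff_quot f x t u) \<le> e + e"
          using elim(1) Kd by (simp add: dist_norm norm_minus_commute)
        then have "dist (diff_quot f x t d) y \<le> 4 * e"
          using elim(2) y(2) dist_triangle[of "diff_quot f x t d" y "diff_quot f x t u"]
            dist_triangle2[of "diff_quot f x t u" y l] by simp
        then show ?case using e by (simp add: dist_norm)
      qed
      then obtain b where b: "0 < b"
        "\<And>t. 0 < t \<Longrightarrow> t < b \<Longrightarrow> norm (diff_quot f x t d - y) \<le> 1 / real (Suc j)"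
        unfolding eventually_at_right_field by blast
      obtain m' where m': "1 / real (Suc m') < b"
        using reals_Archimedean[OF b(1)] by (auto simp: inverse_eq_divide)
      \<comment> \<open>\<open>m\<close> depends on \<open>d\<close> and \<open>y\<close>, but there
        is no circularity: \<open>d\<close> was chosen with the constant \<open>K\<close> of
        \<open>P N\<close>, and the bound of \<open>diff_quot_add_approx\<close> does not contain
        the constant for \<open>m\<close>.\<close>
      define m where "m = max N m'"
      have "1 / real (Suc m) \<le> 1 / real (Suc m')"
        by (simp add: m_def frac_le)
      with m' have "1 / real (Suc m) < b" by linarith
      moreover have "x \<in> P m"
        using N Lipschitz_near_mono[of f "real (Suc N)" x "real (Suc m)"] by (simp add: P_def m_def)
      ultimately have xQ: "x \<in> Q (m, j, d, y)"
        using b(2) unfolding Q_def by fastforce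
      have QF: "Q (m, j, d, y) \<in> F"
        using d y unfolding F_def by blast
      have "\<forall>\<^sub>F t in at_right 0. norm (diff_quot f x t (w + d) - diff_quot f x t w - y) \<le> 4 * e + e"
      proof (rule diff_quot_add_approx[where K = "real (Suc m)" and A = "Q (m, j, d, y)"])
        show "Lipschitz_near f (real (Suc m)) z" if "z \<in> Q (m, j, d, y)" for z
          using that by (auto simp: Q_def P_def)
        show "norm (diff_quot f z t d - y) \<le> 4 * e"
          if "z \<in> Q (m, j, d, y)" "0 < t" "t < 1 / real (Suc m)" for z t
          using that e(2) by (auto simp: Q_def)
      qed (use xQ nonporous[OF QF xQ] e in auto)
      then show "\<forall>\<^sub>F t in at_right 0. dist (diff_quot f x t (w + u) - diff_quot f x t w) l < e'"
        using lip[OF e(1), of "w + u" "w + d"]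
      proof eventually_elim
        case (elim t)
        have "diff_quot f x t (w + u) - diff_quot f x t w - l
            = (diff_quot f x t (w + u) - diff_quot f x t (w + d))
              + (diff_quot f x t (w + d) - diff_quot f x t w - y) + (y - l)"
          by simp
        also have "norm \<dots> \<le> norm (diff_quot f x t (w + u) - diff_quot f x t (w + d))
              + norm (diff_quot f x t (w + d) - diff_quot f x t w - y) + norm (y - l)"
          by (meson add_mono norm_triangle_le order_refl)
        also have "\<dots> < (e + e) + (4 * e + e) + e"
          using elim Kd y(2) by (simp add: dist_norm)
        also have "\<dots> \<le> e'" using e j by simp
        finally show ?case by (simp add: dist_norm)
      qed
    qed
    show ?thesis
      using S(2) unfolding has_right_directional_derivative_def diff_quot_def[symmetric]
      by (intro Gateaux_differentiable_atI[OF lip K add S(1)]) auto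
  qed
  ultimately show ?thesis
    by (intro exI[of _ A]) blast
qed

end
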